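(* For every integer $n \geq 7$, the $n$-gear graph $G_n$ satisfies $rn(G_n) \leq 4n+2$.
   Context: All graphs are simple and connected; $d(u,v)$ is the graph distance and $\operatorname{diam}(G)$ the diameter. A radio labeling of $G$ is a one-to-one map $c: V(G) \to \mathbb{Z}_{+}$ (positive integers) such that $d(u,v) + |c(u)-c(v)| \geq \operatorname{diam}(G)+1$ for all distinct $u,v \in V(G)$. The span of $c$ is the maximum value of $c$; the radio number $rn(G)$ is the minimum span over all radio labelings of $G$. The $n$-gear $G_n$ is the graph consisting of a cycle on $2n$ vertices together with an additional center vertex adjacent to every other vertex of the cycle; it has $2n+1$ vertices and $3n$ edges. *)

theory Defs
  imports "Graph_Theory.Graph_Theory"
begin

text \<open>
  Simple undirected graphs are the symmetric loop-free digraphs of the library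
  (locale \<^locale>\<open>graph\<close>): each undirected edge is a pair of opposite arcs.
\<close>

definition graph_dist :: "('a, 'b) pre_digraph \<Rightarrow> 'a \<Rightarrow> 'a \<Rightarrow> nat" where
  "graph_dist G u v = (LEAST k. \<exists>p. pre_digraph.awalk G u p v \<and> length p = k)"

definition graph_diam :: "('a, 'b) pre_digraph \<Rightarrow> nat" where
  "graph_diam G = Max {graph_dist G u v | u v. u \<in> verts G \<and> v \<in> verts G}"

definition radio_labeling :: "('a, 'b) pre_digraph \<Rightarrow> ('a \<Rightarrow> nat) \<Rightarrow> bool" where
  "radio_labeling G c \<longleftrightarrow>
     inj_on c (verts G) \<and>
     (\<forall>v \<in> verts G. 0 < c v) \<and>
     (\<forall>u \<in> verts G. \<forall>v \<in> verts G. u \<noteq> v \<longrightarrow>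
        int (graph_dist G u v) + \<bar>int (c u) - int (c v)\<bar> \<ge> int (graph_diam G) + 1)"

definition labeling_span :: "('a, 'b) pre_digraph \<Rightarrow> ('a \<Rightarrow> nat) \<Rightarrow> nat" where
  "labeling_span G c = Max (c ` verts G)"

definition radio_number :: "('a, 'b) pre_digraph \<Rightarrow> nat" where
  "radio_number G = (LEAST s. \<exists>c. radio_labeling G c \<and> labeling_span G c = s)"

datatype gear_vertex = Center | Rim nat

definition gear_edges :: "nat \<Rightarrow> (gear_vertex \<times> gear_vertex) set" where
  "gear_edges n =
     {(Rim i, Rim (Suc i mod (2 * n))) | i. i < 2 * n} \<union>
     {(Center, Rim (2 * i)) | i. i < n}"

definition gear :: "nat \<Rightarrow> gear_vertex pair_pre_digraph" where
  "gear n = \<lparr> pverts = insert Center (Rim ` {..<2 * n}),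
              parcs = gear_edges n \<union> (gear_edges n)\<inverse> \<rparr>"

lemma pair_graph_gear:
  assumes "n \<ge> 2"
  shows "pair_graph (gear n)"
proof -
  have fin: "finite (gear_edges n)"
    unfolding gear_edges_def by simp
  have loop: "Suc i mod (2 * n) \<noteq> i" if "i < 2 * n" for i
    using that assms by (cases "Suc i = 2 * n") auto
  show ?thesis
  proof
    show "finite (parcs (gear n))" using fin by (simp add: gear_def)
    show "symmetric (with_proj (gear n))"
      by (auto simp: symmetric_def gear_def sym_def)
    show "fst e \<noteq> snd e" if "e \<in> parcs (gear n)" for e
      using that loop by (fastforce simp: gear_def gear_edges_def)
  qed (use assms in \<open>auto simp: gear_def gear_edges_def\<close>)
qed

lemma connected_gear:
  assumes "n \<ge> 2"
  shows "connected (with_proj (gear n))"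
proof -
  interpret pair_graph "gear n" using assms by (rule pair_graph_gear)
  have symr: "v \<rightarrow>\<^sup>*\<^bsub>with_proj (gear n)\<^esub> u" if "u \<rightarrow>\<^sup>*\<^bsub>with_proj (gear n)\<^esub> v" for u v
    using that by (rule symmetric_reachable[OF sym_arcs])
  have even: "Center \<rightarrow>\<^sup>*\<^bsub>with_proj (gear n)\<^esub> Rim (2 * i)" if "i < n" for i
    using that by (intro reachable_adjI) (auto simp: gear_def gear_edges_def)
  have hub: "Center \<rightarrow>\<^sup>*\<^bsub>with_proj (gear n)\<^esub> Rim i" if "i < 2 * n" for i
  proof (cases "even i")
    case True
    then obtain k where "i = 2 * k" by blast
    with that even show ?thesis by simp
  next
    case False
    then obtain k where k: "i = Suc (2 * k)" using oddE by fastforce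
    then have kn: "k < n" using that by simp
    have "(Rim (2 * k), Rim i) \<in> gear_edges n"
      using k that kn by (auto simp: gear_edges_def intro!: exI[of _ "2 * k"])
    then have "Rim (2 * k) \<rightarrow>\<^sup>*\<^bsub>with_proj (gear n)\<^esub> Rim i"
      by (intro reachable_adjI) (simp add: gear_def)
    with even[OF kn] show ?thesis by (rule reachable_trans)
  qed
  have hub': "Center \<rightarrow>\<^sup>*\<^bsub>with_proj (gear n)\<^esub> v" if "v \<in> pverts (gear n)" for v
  proof (cases v)
    case Center
    have "Center \<rightarrow>\<^sup>*\<^bsub>with_proj (gear n)\<^esub> Center"
      by (rule reachable_refl) (simp add: gear_def)
    with Center show ?thesis by (simp only:)
  next
    case (Rim i)
    with that have "i < 2 * n" by (auto simp: gear_def)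
    with Rim show ?thesis by (simp only: hub)
  qed
  have "strongly_connected (with_proj (gear n))"
    unfolding strongly_connected_def
  proof (intro conjI ballI)
    show "verts (with_proj (gear n)) \<noteq> {}" by (simp add: gear_def)
    fix u v
    assume "u \<in> verts (with_proj (gear n))" "v \<in> verts (with_proj (gear n))"
    then have "Center \<rightarrow>\<^sup>*\<^bsub>with_proj (gear n)\<^esub> u" "Center \<rightarrow>\<^sup>*\<^bsub>with_proj (gear n)\<^esub> v"
      by (simp_all add: hub')
    then show "u \<rightarrow>\<^sup>*\<^bsub>with_proj (gear n)\<^esub> v"
      by (blast intro: symr reachable_trans)
  qed
  moreover have "symcl (parcs (gear n)) = parcs (gear n)"
    by (auto simp: symcl_def gear_def)
  ultimately show ?thesis
    by (simp add: connected_conv strongly_connected_def reachable_def)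
qed

lemma card_verts_gear: "card (pverts (gear n)) = 2 * n + 1"
proof -
  have "card (Rim ` {..<2 * n}) = 2 * n"
    by (subst card_image) (auto simp: inj_on_def)
  moreover have "Center \<notin> Rim ` {..<2 * n}" by blast
  ultimately show ?thesis by (simp add: gear_def)
qed

lemma card_arcs_gear:
  assumes "n \<ge> 2"
  shows "card (parcs (gear n)) = 2 * (3 * n)"
proof -
  let ?A = "(\<lambda>i. (Rim i, Rim (Suc i mod (2 * n)))) ` {..<2 * n}"
  let ?B = "(\<lambda>i. (Center, Rim (2 * i))) ` {..<n}"
  have E: "gear_edges n = ?A \<union> ?B" by (auto simp: gear_edges_def)
  have "card ?A = 2 * n" by (subst card_image) (auto simp: inj_on_def)
  moreover have "card ?B = n" by (subst card_image) (auto simp: inj_on_def)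
  ultimately have c: "card (gear_edges n) = 3 * n"
    unfolding E by (subst card_Un_disjoint) auto
  have noback: "Suc (Suc i mod (2 * n)) mod (2 * n) \<noteq> i" if "i < 2 * n" for i
  proof
    assume "Suc (Suc i mod (2 * n)) mod (2 * n) = i"
    then have eq: "(i + 2) mod (2 * n) = i" by (simp add: mod_Suc_eq)
    show False
    proof (cases "i + 2 < 2 * n")
      case True
      with eq show False by simp
    next
      case False
      then have "(i + 2) mod (2 * n) = i + 2 - 2 * n"
        using that assms by (simp add: le_mod_geq)
      with eq that assms False show False by linarith
    qed
  qed
  have "gear_edges n \<inter> (gear_edges n)\<inverse> = {}"
  proof -
    have False if e: "e \<in> gear_edges n" "e \<in> (gear_edges n)\<inverse>" for e
    proof -
      obtain i where "i < 2 * n" "e = (Rim i, Rim (Suc i mod (2 * n)))"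
        using e unfolding gear_edges_def by blast
      moreover from e(2) obtain j where "j < 2 * n" "e = (Rim (Suc j mod (2 * n)), Rim j)"
        using calculation unfolding gear_edges_def by blast
      ultimately show False using noback by (metis gear_vertex.inject prod.inject)
    qed
    then show ?thesis by blast
  qed
  moreover have "finite (gear_edges n)" by (simp add: E)
  ultimately show ?thesis
    by (simp add: gear_def card_Un_disjoint c)
qed

end

theory Submission
  imports Defs
begin

text \<open>
  The diameter is at most 4, since every vertex is within distance 2 of the center.
  Label the center 1, the \<open>n\<close> rim vertices of degree 2 with \<open>4, \<dots>, n + 3\<close>, and the \<open>n\<close>
  rim vertices of degree 3 with \<open>n + 5, n + 8, \<dots>, 4 n + 2\<close>. Two vertices of degree 2
  are at distance 4 unless they have a common rim neighbour, so consecutive labels are allowed on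
  them as long as cyclically consecutive ones receive labels differing by at least 3; this is
  achieved by using, around the rim, the label offsets 0, 3, 6, \<dots>, then 2, 5, 8, \<dots>, then
  1, 4, 7, \<dots>. Distances are bounded below by functions that vary by at most 1 along each arc.
\<close>

section \<open>Distances from walks and from Lipschitz functions\<close>

context wf_digraph
begin

lemma graph_dist_le: "awalk u p v \<Longrightarrow> graph_dist G u v \<le> length p"
  unfolding graph_dist_def by (rule Least_le) blast

text \<open>Reachability makes the set of walk lengths nonempty, so the \<open>LEAST\<close> in
  \<open>graph_dist\<close> is a genuine minimum.\<close>

lemma graph_dist_attained:
  assumes "u \<rightarrow>\<^sup>* v"
  obtains p where "awalk u p v" "length p = graph_dist G u v"
proof -
  from assms obtain p where "awalk u p v" by (auto simp: reachable_awalk)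
  then have "\<exists>k p. awalk u p v \<and> length p = k" by blast
  then have "\<exists>p. awalk u p v \<and> length p = graph_dist G u v"
    unfolding graph_dist_def by (rule LeastI_ex)
  with that show thesis by blast
qed

text \<open>Triangle inequality along the walk. A suitable \<open>h\<close> thus certifies a lower
  bound on a distance without any analysis of walks.\<close>

lemma abs_diff_le_length_awalk:
  fixes h :: "'a \<Rightarrow> int"
  assumes "awalk u p v"
    and "\<And>e. e \<in> arcs G \<Longrightarrow> \<bar>h (tail G e) - h (head G e)\<bar> \<le> 1"
  shows "\<bar>h u - h v\<bar> \<le> int (length p)"
  using assms(1)
proof (induction p arbitrary: u)
  case Nil
  then show ?case by (simp add: awalk_Nil_iff)
next
  case (Cons e p)
  then have "e \<in> arcs G" "u = tail G e" "awalk (head G e) p v"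
    by (auto simp: awalk_Cons_iff)
  with Cons.IH[of "head G e"] assms(2)[of e] show ?case by simp
qed

lemma abs_diff_le_graph_dist:
  fixes h :: "'a \<Rightarrow> int"
  assumes "u \<rightarrow>\<^sup>* v"
    and "\<And>e. e \<in> arcs G \<Longrightarrow> \<bar>h (tail G e) - h (head G e)\<bar> \<le> 1"
  shows "\<bar>h u - h v\<bar> \<le> int (graph_dist G u v)"
  using graph_dist_attained[OF assms(1)] abs_diff_le_length_awalk[OF _ assms(2)] by metis

end

section \<open>Diameter, radio labelings and radio number\<close>

lemma finite_graph_dists:
  assumes "finite (verts G)"
  shows "finite {graph_dist G u v | u v. u \<in> verts G \<and> v \<in> verts G}"
  using assms by (rule finite_image_set2[where P = "\<lambda>u. u \<in> verts G", simplified]) (use assms in simp)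

lemma graph_dist_le_diam:
  assumes "finite (verts G)" "u \<in> verts G" "v \<in> verts G"
  shows "graph_dist G u v \<le> graph_diam G"
  unfolding graph_diam_def using finite_graph_dists assms by (intro Max_ge) auto

lemma graph_diam_le:
  assumes "finite (verts G)" "verts G \<noteq> {}"
    and "\<And>u v. u \<in> verts G \<Longrightarrow> v \<in> verts G \<Longrightarrow> graph_dist G u v \<le> k"
  shows "graph_diam G \<le> k"
proof -
  from assms(2) have "{graph_dist G u v | u v. u \<in> verts G \<and> v \<in> verts G} \<noteq> {}" by blast
  with assms(3) show ?thesis
    unfolding graph_diam_def using finite_graph_dists[OF assms(1)] by auto
qed

text \<open>Separation against an upper bound \<open>k\<close> of the diameter is the stronger
  condition. It also gives injectivity: two vertices with equal labels would be at distance at least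
  \<open>k + 1\<close>, beyond the diameter.\<close>

lemma radio_labelingI:
  assumes "finite (verts G)" "graph_diam G \<le> k"
    and "\<And>v. v \<in> verts G \<Longrightarrow> 0 < c v"
    and sep: "\<And>u v. u \<in> verts G \<Longrightarrow> v \<in> verts G \<Longrightarrow> u \<noteq> v \<Longrightarrow>
      int k + 1 \<le> int (graph_dist G u v) + \<bar>int (c u) - int (c v)\<bar>"
  shows "radio_labeling G c"
proof -
  have "inj_on c (verts G)"
  proof (rule inj_onI, rule ccontr)
    fix u v assume "u \<in> verts G" "v \<in> verts G" "c u = c v" "u \<noteq> v"
    with sep[of u v] graph_dist_le_diam[OF assms(1), of u v] assms(2) show False by simp
  qed
  with assms show ?thesis unfolding radio_labeling_def by fastforce
qed

lemma radio_number_le: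
  assumes "radio_labeling G c" "finite (verts G)" "verts G \<noteq> {}"
    and "\<And>v. v \<in> verts G \<Longrightarrow> c v \<le> s"
  shows "radio_number G \<le> s"
proof -
  have "radio_number G \<le> labeling_span G c"
    unfolding radio_number_def using assms(1) by (intro Least_le) blast
  also have "\<dots> \<le> s" unfolding labeling_span_def using assms by simp
  finally show ?thesis .
qed

section \<open>Vertices and edges of the gear by parity\<close>

text \<open>\<open>Rim (2 * e)\<close> and \<open>Rim (2 * k + 1)\<close> are adjacent in \<open>gear n\<close>.\<close>
definition rim_adj :: "nat \<Rightarrow> nat \<Rightarrow> nat \<Rightarrow> bool" where
  "rim_adj n e k \<longleftrightarrow> e = k \<or> e = Suc k mod n"

lemma gear_vertex_cases:
  assumes "v \<in> pverts (gear n)"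
  obtains "v = Center" | e where "e < n" "v = Rim (2 * e)" | k where "k < n" "v = Rim (2 * k + 1)"
proof -
  consider "v = Center" | i where "i < 2 * n" "v = Rim i" using assms by (auto simp: gear_def)
  then show thesis
  proof cases
    case 2
    then show thesis using that(2)[of "i div 2"] that(3)[of "i div 2"]
      by (cases "even i") (auto elim!: evenE oddE)
  qed (rule that)
qed

text \<open>A rim edge may start at either parity; the unordered pair in the second case absorbs the
  orientation.\<close>

lemma gear_edge_cases:
  assumes "(x, y) \<in> gear_edges n"
  obtains e where "e < n" "x = Center" "y = Rim (2 * e)"
  | e k where "e < n" "k < n" "rim_adj n e k" "{x, y} = {Rim (2 * e), Rim (2 * k + 1)}"
proof -
  consider e where "e < n" "x = Center" "y = Rim (2 * e)"
    | i where "i < 2 * n" "x = Rim i" "y = Rim (Suc i mod (2 * n))"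
    using assms by (auto simp: gear_edges_def)
  then show thesis
  proof cases
    case (2 i)
    show thesis
    proof (cases "even i")
      case True
      then obtain k where "i = 2 * k" by blast
      then show thesis using 2 that(2)[of k k] by (simp add: rim_adj_def)
    next
      case False
      then obtain k where k: "i = 2 * k + 1" by (rule oddE)
      have "Suc i mod (2 * n) = 2 * (Suc k mod n)"
        using k mult_mod_right[of 2 "Suc k" n] by simp
      moreover have "k < n" "Suc k mod n < n" using 2 k by simp_all
      ultimately show thesis
        using 2 k that(2)[of "Suc k mod n" k] by (simp add: rim_adj_def insert_commute)
    qed
  qed (rule that)
qed

lemma gear_lipschitz:
  fixes h :: "gear_vertex \<Rightarrow> int"
  assumes "\<And>e. e < n \<Longrightarrow> \<bar>h Center - h (Rim (2 * e))\<bar> \<le> 1"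
    and "\<And>e k. e < n \<Longrightarrow> k < n \<Longrightarrow> rim_adj n e k \<Longrightarrow>
      \<bar>h (Rim (2 * e)) - h (Rim (2 * k + 1))\<bar> \<le> 1"
    and "a \<in> parcs (gear n)"
  shows "\<bar>h (fst a) - h (snd a)\<bar> \<le> 1"
proof -
  have *: "\<bar>h x - h y\<bar> \<le> 1" if "(x, y) \<in> gear_edges n" for x y
    using that
  proof (cases rule: gear_edge_cases)
    case (2 e k)
    with assms(2)[of e k] show ?thesis by (auto simp: doubleton_eq_iff abs_minus_commute)
  qed (use assms(1) in simp)
  from assms(3) have "(fst a, snd a) \<in> gear_edges n \<or> (snd a, fst a) \<in> gear_edges n"
    by (auto simp: gear_def)
  with *[of "fst a" "snd a"] *[of "snd a" "fst a"] show ?thesis by linarith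
qed

section \<open>Distances in the gear\<close>

locale gear_graph =
  fixes n :: nat
  assumes n_ge: "n \<ge> 2"
begin

sublocale pair_graph "gear n"
  using n_ge by (rule pair_graph_gear)

abbreviation "gdist \<equiv> graph_dist (with_proj (gear n))"

lemma reachable_gear:
  assumes "u \<in> pverts (gear n)" "v \<in> pverts (gear n)"
  shows "u \<rightarrow>\<^sup>*\<^bsub>with_proj (gear n)\<^esub> v"
proof -
  have "strongly_connected (with_proj (gear n))"
    using connected_gear[OF n_ge] sym_arcs symmetric_connected_imp_strongly_connected by blast
  with assms show ?thesis by (auto simp: strongly_connected_def)
qed

lemma abs_diff_le_gdist:
  fixes h :: "gear_vertex \<Rightarrow> int"
  assumes "u \<in> pverts (gear n)" "v \<in> pverts (gear n)"
    and "\<And>e. e < n \<Longrightarrow> \<bar>h Center - h (Rim (2 * e))\<bar> \<le> 1"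
    and "\<And>e k. e < n \<Longrightarrow> k < n \<Longrightarrow> rim_adj n e k \<Longrightarrow>
      \<bar>h (Rim (2 * e)) - h (Rim (2 * k + 1))\<bar> \<le> 1"
  shows "\<bar>h u - h v\<bar> \<le> int (gdist u v)"
  using abs_diff_le_graph_dist[OF reachable_gear[OF assms(1,2)], of h]
    gear_lipschitz[of n h, OF assms(3,4)] by simp

lemma gdist_commute: "gdist u v = gdist v u"
proof -
  have "\<exists>q. awalk v q u \<and> length q = length p" if "awalk u p v" for u v p
    using that
  proof (induction p arbitrary: u)
    case Nil
    then show ?case by (auto simp: awalk_Nil_iff)
  next
    case (Cons a p)
    then obtain q where q: "awalk v q (snd a)" "length q = length p"
      and a: "a \<in> parcs (gear n)" "u = fst a"
      by (auto simp: awalk_Cons_iff)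
    from a have "awalk (snd a) [(snd a, fst a)] u"
      by (auto simp: arc_to_ends_def awalk_Cons_iff awalk_Nil_iff intro: arcs_symmetric)
    with q(1) have "awalk v (q @ [(snd a, fst a)]) u" by (rule awalk_appendI)
    with q(2) show ?case by (intro exI[of _ "q @ [(snd a, fst a)]"]) simp
  qed
  then have "(\<exists>p. awalk u p v \<and> length p = k) \<longleftrightarrow> (\<exists>p. awalk v p u \<and> length p = k)" for k
    by metis
  then show ?thesis unfolding graph_dist_def by simp
qed

lemma gdist_triangle:
  assumes "u \<in> pverts (gear n)" "v \<in> pverts (gear n)" "w \<in> pverts (gear n)"
  shows "gdist u w \<le> gdist u v + gdist v w"
proof -
  obtain p q where "awalk u p v" "length p = gdist u v" "awalk v q w" "length q = gdist v w"
    using graph_dist_attained reachable_gear assms by metis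
  then show ?thesis using graph_dist_le[of u "p @ q" w] by (simp add: awalk_appendI)
qed

lemma gdist_Center_le:
  assumes "v \<in> pverts (gear n)"
  shows "gdist Center v \<le> 2"
  using assms
proof (cases rule: gear_vertex_cases)
  case 1
  then have "awalk Center [] v" using assms by (simp add: awalk_Nil_iff)
  then show ?thesis using graph_dist_le[of Center "[]" v] by simp
next
  case (2 e)
  then have "(Center, v) \<in> parcs (gear n)" by (auto simp: gear_def gear_edges_def)
  then have "awalk Center [(Center, v)] v"
    using assms by (simp add: awalk_Cons_iff awalk_Nil_iff)
  then show ?thesis using graph_dist_le[of Center "[(Center, v)]" v] by simp
next
  case (3 k)
  let ?w = "Rim (2 * k)"
  have "(Center, ?w) \<in> parcs (gear n)" using 3 by (auto simp: gear_def gear_edges_def)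
  moreover have "(?w, v) \<in> parcs (gear n)"
    using 3 by (auto simp: gear_def gear_edges_def intro!: exI[of _ "2 * k"])
  ultimately have "awalk Center [(Center, ?w), (?w, v)] v"
    using assms by (simp add: awalk_Cons_iff awalk_Nil_iff)
  then show ?thesis using graph_dist_le[of Center "[(Center, ?w), (?w, v)]" v] by simp
qed

lemma graph_diam_gear_le: "graph_diam (with_proj (gear n)) \<le> 4"
proof (rule graph_diam_le)
  have C: "Center \<in> pverts (gear n)" by (simp add: gear_def)
  then show "verts (with_proj (gear n)) \<noteq> {}" by auto
  show "gdist u v \<le> 4"
    if "u \<in> verts (with_proj (gear n))" "v \<in> verts (with_proj (gear n))" for u v
    using that gdist_triangle[OF _ C, of u v] gdist_Center_le[of u] gdist_Center_le[of v]
    by (simp add: gdist_commute[of u Center])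
qed simp

lemma Center_in_gear: "Center \<in> pverts (gear n)"
  and even_in_gear: "e < n \<Longrightarrow> Rim (2 * e) \<in> pverts (gear n)"
  and odd_in_gear: "k < n \<Longrightarrow> Rim (2 * k + 1) \<in> pverts (gear n)"
  by (auto simp: gear_def)

text \<open>\<open>h\<close> is the distance from \<open>Rim (2 * s)\<close>, except that every odd
  rim vertex gets 1. This keeps \<open>h\<close> Lipschitz without reference to
  \<open>rim_adj\<close>, and stays exact at the center and the even rim vertices.\<close>

lemma gdist_even_ge:
  fixes s :: nat
  defines "h \<equiv> \<lambda>v. case v of Center \<Rightarrow> 1
    | Rim i \<Rightarrow> if i = 2 * s then 0 else if even i then 2 else 1"
  assumes "s < n" "v \<in> pverts (gear n)"
  shows "h v \<le> int (gdist (Rim (2 * s)) v)"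
proof -
  have "2 * k + 1 \<noteq> 2 * s" for k by presburger
  then have "\<bar>h (Rim (2 * s)) - h v\<bar> \<le> int (gdist (Rim (2 * s)) v)"
    using assms(2,3) by (intro abs_diff_le_gdist even_in_gear) (auto simp: h_def)
  then show ?thesis by (simp add: h_def)
qed

text \<open>\<open>h\<close> is the exact distance from \<open>Rim (2 * s + 1)\<close>. It is
  Lipschitz because a rim neighbour of a vertex with value 1 has value 0 or 2 by the existential
  clause.\<close>

lemma gdist_odd_ge:
  fixes s :: nat
  defines "h \<equiv> \<lambda>v. case v of Center \<Rightarrow> 2
    | Rim i \<Rightarrow> if even i then (if rim_adj n (i div 2) s then 1 else 3)
        else if i div 2 = s then 0
        else if \<exists>e. rim_adj n e (i div 2) \<and> rim_adj n e s then 2 else 4"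
  assumes "s < n" "v \<in> pverts (gear n)"
  shows "h v \<le> int (gdist (Rim (2 * s + 1)) v)"
proof -
  have "\<bar>h (Rim (2 * s + 1)) - h v\<bar> \<le> int (gdist (Rim (2 * s + 1)) v)"
    using assms(2,3) by (intro abs_diff_le_gdist odd_in_gear) (auto simp: h_def)
  then show ?thesis by (simp add: h_def)
qed

end

section \<open>Offsets for the rim vertices of degree 2\<close>

text \<open>Lists the numbers below \<open>n\<close> by residue modulo 3 in the order 0, 2, 1;
  \<open>a\<close> and \<open>b\<close> count those with residue 0 and 2. The order 0, 1, 2 would
  put 4 next to 2 when \<open>n = 7\<close>.\<close>

definition spread :: "nat \<Rightarrow> nat \<Rightarrow> nat" where
  "spread n i = (let a = (n + 2) div 3; b = n div 3 in
     if i < a then 3 * i else if i < a + b then 3 * (i - a) + 2 else 3 * (i - a - b) + 1)"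

text \<open>Trades \<open>div\<close> for linear inequalities on the block lengths, ready for linear
  arithmetic.\<close>

lemma spread_cases:
  obtains a b where "n \<le> 3 * a" "3 * a \<le> n + 2" "n \<le> 3 * b + 2" "3 * b \<le> n"
    "2 * n \<le> 3 * a + 3 * b + 1" "3 * a + 3 * b \<le> 2 * n + 1"
    "\<And>i. spread n i =
      (if i < a then 3 * i else if i < a + b then 3 * (i - a) + 2 else 3 * (i - a - b) + 1)"
proof (rule that[of "(n + 2) div 3" "n div 3"])
  show "spread n i = (if i < (n + 2) div 3 then 3 * i
    else if i < (n + 2) div 3 + n div 3 then 3 * (i - (n + 2) div 3) + 2
    else 3 * (i - (n + 2) div 3 - n div 3) + 1)" for i
    by (simp add: spread_def Let_def)
qed presburger+

lemma spread_less:
  assumes "i < n"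
  shows "spread n i < n"
proof (cases rule: spread_cases[of n])
  case (1 a b)
  then show ?thesis using assms by (auto simp only: 1(7) split: if_split)
qed

text \<open>\<open>g\<close> is a left inverse: the residue modulo 3 identifies the block, the
  quotient the position in it.\<close>

lemma spread_inj:
  assumes "spread n i = spread n j"
  shows "i = j"
proof (cases rule: spread_cases[of n])
  case (1 a b)
  define g where "g x = (if x mod 3 = 0 then x div 3 else
    if x mod 3 = 2 then a + x div 3 else a + b + x div 3)" for x :: nat
  have "(3 * k + 2) mod 3 = 2" "(3 * k + 2) div 3 = k" "(3 * k + 1) mod 3 = 1" "(3 * k + 1) div 3 = k"
    for k :: nat
    by presburger+
  then have g: "g (3 * k) = k" "g (3 * k + 2) = a + k" "g (3 * k + 1) = a + b + k" for k
    unfolding g_def by (simp_all only:) simp_all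
  have "g (spread n i) = i" for i
  proof -
    consider "i < a" | "\<not> i < a" "i < a + b" | "\<not> i < a" "\<not> i < a + b" by blast
    then show ?thesis by cases (simp_all only: 1(7) g if_True if_False)
  qed
  with assms show ?thesis by metis
qed

text \<open>Inside a block the gap is exactly 3, so only the two block changes and the wrap-around
  matter; there \<open>n \<ge> 7\<close> makes the blocks long enough.\<close>

lemma spread_consecutive:
  assumes "n \<ge> 7" "i < n"
  shows "3 \<le> \<bar>int (spread n i) - int (spread n (Suc i mod n))\<bar>"
proof (cases rule: spread_cases[of n])
  case (1 a b)
  have ab: "a \<ge> 3" "b \<ge> 2" using 1(1,3) assms(1) by linarith+
  show ?thesis
  proof (cases "Suc i = n")
    case True
    have "a + b \<le> i" using True 1(6) assms(1) by linarith
    then have "spread n i = 3 * (i - a - b) + 1" by (simp add: 1(7))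
    moreover have "3 * (i - a - b) \<ge> 2" using \<open>a + b \<le> i\<close> True 1(6) assms(1) by linarith
    moreover have "spread n (Suc i mod n) = 0" using True ab by (simp add: 1(7))
    ultimately show ?thesis by simp
  next
    case False
    then have S: "Suc i mod n = Suc i" using assms(2) by simp
    consider "Suc i < a" | "Suc i = a" | "a \<le> i" "Suc i < a + b" | "Suc i = a + b" | "a + b \<le> i"
      by linarith
    then show ?thesis
    proof cases
      case 4
      then have "spread n i = 3 * (i - a) + 2" "spread n (Suc i) = 1" "i - a \<ge> 1"
        using ab by (simp_all add: 1(7))
      then show ?thesis unfolding S by simp
    qed (use ab in \<open>auto simp: S 1(7) of_nat_diff\<close>)
  qed
qed

section \<open>The labeling and the upper bound\<close>

text \<open>
  Vertex \<open>Rim 2\<close> gets the smallest label of the even rim vertices: its neighbours \<open>Rim 1\<close>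
  and \<open>Rim 3\<close> carry the small labels 4 and 7, whereas the neighbour \<open>Rim (2 * n - 1)\<close> of
  \<open>Rim 0\<close> may carry a label as large as \<open>n + 3\<close>.
\<close>
definition swap01 :: "nat \<Rightarrow> nat" where
  "swap01 e = (if e = 0 then 1 else if e = 1 then 0 else e)"

text \<open>Odd rim vertices lie at distance 2 from the center, so their labels start at 1 + 3.
  Their largest label is \<open>n + 3\<close>, and distance 3 to a non-adjacent even rim vertex
  requires a gap of 2, hence \<open>n + 5\<close>. Even rim vertices are at mutual distance 2, hence
  the factor 3.\<close>

fun gear_label :: "nat \<Rightarrow> gear_vertex \<Rightarrow> nat" where
  "gear_label n Center = 1"
| "gear_label n (Rim i) =
    (if odd i then 4 + spread n (i div 2) else n + 5 + 3 * swap01 (i div 2))"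

lemma gear_label_separated:
  assumes "n \<ge> 7" "u \<in> pverts (gear n)" "v \<in> pverts (gear n)" "u \<noteq> v"
  shows "5 \<le> int (graph_dist (with_proj (gear n)) u v)
    + \<bar>int (gear_label n u) - int (gear_label n v)\<bar>"
proof -
  interpret gear_graph n using assms(1) by unfold_locales simp
  let ?P = "\<lambda>u v. 5 \<le> int (gdist u v) + \<bar>int (gear_label n u) - int (gear_label n v)\<bar>"
  have sym: "?P v u" if "?P u v" for u v
    using that by (simp add: gdist_commute[of v u] abs_minus_commute)
  have even_C: "?P (Rim (2 * e)) Center" if "e < n" for e
    using gdist_even_ge[OF that Center_in_gear] assms(1) by simp
  have even_even: "?P (Rim (2 * e)) (Rim (2 * e'))" if "e < n" "e' < n" "e \<noteq> e'" for e e'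
  proof -
    have "2 \<le> int (gdist (Rim (2 * e)) (Rim (2 * e')))"
      using gdist_even_ge[OF that(1) even_in_gear[OF that(2)]] that(3) by simp
    moreover have "swap01 e \<noteq> swap01 e'" using that(3) by (auto simp: swap01_def)
    ultimately show ?thesis by simp
  qed
  have odd_C: "?P (Rim (2 * k + 1)) Center" if "k < n" for k
    using gdist_odd_ge[OF that Center_in_gear] by simp
  have odd_even: "?P (Rim (2 * k + 1)) (Rim (2 * e))" if "k < n" "e < n" for k e
  proof (cases "rim_adj n e k")
    case False
    then have "3 \<le> int (gdist (Rim (2 * k + 1)) (Rim (2 * e)))"
      using gdist_odd_ge[OF that(1) even_in_gear[OF that(2)]] by simp
    then show ?thesis using spread_less[OF that(1)] by simp
  next
    case True
    then have "1 \<le> int (gdist (Rim (2 * k + 1)) (Rim (2 * e)))"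
      using gdist_odd_ge[OF that(1) even_in_gear[OF that(2)]] by simp
    \<comment> \<open>Equivalent to a label gap of at least 4, as adjacent vertices require.\<close>
    moreover have "spread n k + 3 \<le> n + 3 * swap01 e"
    proof (cases "e = 1")
      case e: True
      with True have "k = 1 \<or> Suc k mod n = 1" by (auto simp: rim_adj_def)
      then have "k = 1 \<or> k = 0"
        using \<open>k < n\<close> assms(1) by (cases "Suc k = n") auto
      then show ?thesis using assms(1) by (auto simp: spread_def Let_def)
    next
      case False
      then have "swap01 e \<ge> 1" by (simp add: swap01_def)
      then show ?thesis using spread_less[OF that(1)] by simp
    qed
    ultimately show ?thesis by simp
  qed
  have odd_odd: "?P (Rim (2 * k + 1)) (Rim (2 * l + 1))" if "k < n" "l < n" "k \<noteq> l" for k l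
  proof (cases "\<exists>e. rim_adj n e l \<and> rim_adj n e k")
    case False
    then have "4 \<le> int (gdist (Rim (2 * k + 1)) (Rim (2 * l + 1)))"
      using gdist_odd_ge[OF that(1) odd_in_gear[OF that(2)]] that(3) by (simp split: if_splits)
    moreover have "spread n k \<noteq> spread n l" using spread_inj that(3) by blast
    ultimately show ?thesis by simp
  next
    case True
    then have "2 \<le> int (gdist (Rim (2 * k + 1)) (Rim (2 * l + 1)))"
      using gdist_odd_ge[OF that(1) odd_in_gear[OF that(2)]] that(3) by simp
    \<comment> \<open>The common neighbour is \<open>k\<close> or its cyclic successor, and likewise
      for \<open>l\<close>. As successors of distinct indices differ, one index must be the
      successor of the other.\<close>
    moreover have "Suc k mod n \<noteq> Suc l mod n"
      using that by (cases "Suc k = n"; cases "Suc l = n") auto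
    with True that(3) have "l = Suc k mod n \<or> k = Suc l mod n" by (auto simp: rim_adj_def)
    then have "3 \<le> \<bar>int (spread n k) - int (spread n l)\<bar>"
      using spread_consecutive[OF assms(1)] that by (metis abs_minus_commute)
    ultimately show ?thesis by simp
  qed
  from assms(2) show ?thesis
  proof (cases rule: gear_vertex_cases)
    case u: 1
    from assms(3) show ?thesis
      by (cases rule: gear_vertex_cases) (use u assms(4) sym even_C odd_C in blast)+
  next
    case u: (2 e)
    from assms(3) show ?thesis
      by (cases rule: gear_vertex_cases) (use u assms(4) sym even_C even_even odd_even in blast)+
  next
    case u: (3 k)
    from assms(3) show ?thesis
      by (cases rule: gear_vertex_cases) (use u assms(4) odd_C odd_even odd_odd in blast)+
  qed
qed

theorem theorem2p2:
  fixes n :: nat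
  assumes "n \<ge> 7"
  shows "radio_number (with_proj (gear n)) \<le> 4 * n + 2"
proof -
  interpret gear_graph n using assms by unfold_locales simp
  have "radio_labeling (with_proj (gear n)) (gear_label n)"
  proof (rule radio_labelingI[OF _ graph_diam_gear_le])
    show "0 < gear_label n v" for v by (cases v) auto
  qed (use gear_label_separated[OF assms] in auto)
  then show ?thesis
  proof (rule radio_number_le)
    fix v assume "v \<in> verts (with_proj (gear n))"
    then have "v \<in> pverts (gear n)" by simp
    then show "gear_label n v \<le> 4 * n + 2"
      using assms by (cases rule: gear_vertex_cases) (auto dest: spread_less simp: swap01_def)
  qed (use Center_in_gear in auto)
qed

end
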